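(* Every triangle-free graph $G$ with independence number at most $3$ enjoys the strong exchange property.
   Context: All graphs are finite with no loop, no multiple edge and no isolated vertex. Let $G$ be such a graph on $V(G)=\{x_1,\ldots,x_n\}$ with edge set $E(G)$, and let $S=K[x_1,\ldots,x_n]$ be the polynomial ring over a field $K$. The edge ideal $I(G)\subset S$ is generated by the monomials $x_ix_j$ with $\{x_i,x_j\}\in E(G)$. For a monomial ideal $I\subset S$ and $\mathfrak{c}=(c_1,\ldots,c_n)\in\mathbb{Z}_{>0}^n$, $I_{\mathfrak{c}}$ is the ideal generated by the monomials $x_1^{a_1}\cdots x_n^{a_n}\in I$ with $a_i\le c_i$ for all $i$, and $\delta_{\mathfrak{c}}(I)$ is the largest integer $q$ with $(I^q)_{\mathfrak{c}}\neq 0$. Let $\mathcal{W}(\mathfrak{c},G)$ be the minimal set of monomial generators of $(I(G)^{\delta})_{\mathfrak{c}}$, where $\delta=\delta_{\mathfrak{c}}(I(G))$. $\mathcal{W}(\mathfrak{c},G)$ enjoys the strong exchange property if for all $w=x_1^{a_1}\cdots x_n^{a_n}$ and $w'=x_1^{b_1}\cdots x_n^{b_n}$ in $\mathcal{W}(\mathfrak{c},G)$ and all $\xi,\rho$ with $a_\xi>b_\xi$ and $a_\rho<b_\rho$, one has $x_\rho(w/x_\xi)\in\mathcal{W}(\mathfrak{c},G)$. The graph $G$ enjoys the strong exchange property if $\mathcal{W}(\mathfrak{c},G)$ does for every $\mathfrak{c}\in\mathbb{Z}_{>0}^n$. A graph is triangle-free if it contains no cycle of length $3$. The independence number is the largest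 cardinality of an independent set of vertices. *)

theory Defs
  imports HOL.Modules "HOL-Library.Poly_Mapping"
begin

section \<open>Graphs\<close>

text \<open>
  The vertex set is a finite type \<open>'v\<close>, and a graph is given by its set of edges. A vertex
  doubles as the index of the corresponding variable of the polynomial ring.
\<close>

definition simple_graph :: "'v::finite set set \<Rightarrow> bool" where
  "simple_graph E \<longleftrightarrow> (\<forall>e\<in>E. card e = 2) \<and> (\<forall>v. \<exists>e\<in>E. v \<in> e)"

definition triangle_free :: "'v set set \<Rightarrow> bool" where
  "triangle_free E \<longleftrightarrow>
     (\<nexists>x y z. distinct [x, y, z] \<and> {x, y} \<in> E \<and> {y, z} \<in> E \<and> {z, x} \<in> E)"

definition independent_set :: "'v set set \<Rightarrow> 'v set \<Rightarrow> bool" where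
  "independent_set E A \<longleftrightarrow> (\<forall>x\<in>A. \<forall>y\<in>A. {x, y} \<notin> E)"

definition independence_number :: "'v::finite set set \<Rightarrow> nat" where
  "independence_number E = Max {card A | A. independent_set E A}"


section \<open>Ideals in a polynomial ring\<close>

text \<open>
  A monomial is given by its exponent vector in \<open>'v \<Rightarrow>\<^sub>0 nat\<close>; multiplication in the ring
  below is convolution.
\<close>

type_synonym ('v, 'k) mpoly = "('v \<Rightarrow>\<^sub>0 nat) \<Rightarrow>\<^sub>0 'k"

definition monom :: "('v \<Rightarrow>\<^sub>0 nat) \<Rightarrow> ('v, 'k::field) mpoly" where
  "monom a = Poly_Mapping.single a 1"

text \<open>An ideal of a commutative ring is a submodule of the ring over itself.\<close>

definition ideal_gen :: "'a::comm_ring_1 set \<Rightarrow> 'a set" where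
  "ideal_gen B = module.span (*) B"

primrec ideal_power :: "'a::comm_ring_1 set \<Rightarrow> nat \<Rightarrow> 'a set" where
  "ideal_power I 0 = UNIV"
| "ideal_power I (Suc q) = ideal_gen {f * g | f g. f \<in> I \<and> g \<in> ideal_power I q}"

definition edge_ideal :: "'v set set \<Rightarrow> ('v, 'k::field) mpoly set" where
  "edge_ideal E =
     ideal_gen {monom (Poly_Mapping.single x 1 + Poly_Mapping.single y 1) | x y. {x, y} \<in> E}"

definition bounded_part :: "('v \<Rightarrow> nat) \<Rightarrow> ('v, 'k::field) mpoly set \<Rightarrow> ('v, 'k) mpoly set" where
  "bounded_part c I =
     ideal_gen {monom a | a. monom a \<in> I \<and> (\<forall>i. Poly_Mapping.lookup a i \<le> c i)}"

definition delta :: "('v \<Rightarrow> nat) \<Rightarrow> ('v, 'k::field) mpoly set \<Rightarrow> nat" where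
  "delta c I = (GREATEST q. bounded_part c (ideal_power I q) \<noteq> {0})"

definition minimal_monomial_generators ::
    "('v, 'k::field) mpoly set \<Rightarrow> ('v, 'k) mpoly set" where
  "minimal_monomial_generators I =
     (THE M. M \<subseteq> range monom \<and> ideal_gen M = I \<and> (\<forall>M'. M' \<subset> M \<longrightarrow> ideal_gen M' \<noteq> I))"

definition W :: "('v \<Rightarrow> nat) \<Rightarrow> 'v set set \<Rightarrow> ('v, 'k::field) mpoly set" where
  "W c E =
     (let I = edge_ideal E
      in minimal_monomial_generators (bounded_part c (ideal_power I (delta c I))))"


section \<open>The strong exchange property\<close>

text \<open>
  The exponent vector \<open>a - single \<xi> 1 + single \<rho> 1\<close> is that of \<open>x\<^sub>\<rho> (w / x\<^sub>\<xi>)\<close>: the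
  truncated subtraction is exact because the exponent of \<open>x\<^sub>\<xi>\<close> in \<open>w\<close> is positive.
\<close>

definition strong_exchange :: "('v, 'k::field) mpoly set \<Rightarrow> bool" where
  "strong_exchange M \<longleftrightarrow>
     (\<forall>a b \<xi> \<rho>. monom a \<in> M \<longrightarrow> monom b \<in> M \<longrightarrow>
        Poly_Mapping.lookup a \<xi> > Poly_Mapping.lookup b \<xi> \<longrightarrow>
        Poly_Mapping.lookup a \<rho> < Poly_Mapping.lookup b \<rho> \<longrightarrow>
        monom (a - Poly_Mapping.single \<xi> 1 + Poly_Mapping.single \<rho> 1) \<in> M)"

text \<open>The type argument is the coefficient field.\<close>

definition strong_exchange_graph :: "'k::field itself \<Rightarrow> 'v::finite set set \<Rightarrow> bool" where
  "strong_exchange_graph K E \<longleftrightarrow>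
     (\<forall>c. (\<forall>i. 0 < c i) \<longrightarrow> strong_exchange (W c E :: ('v, 'k) mpoly set))"

end

theory Submission
  imports Defs "HOL-Library.Multiset"
begin

text \<open>
  The exponent vector of a product of edges \<open>x\<^sub>i x\<^sub>j\<close> is the degree vector of a multiset of edges,
  and the bound \<open>c\<close> turns such a multiset into a matching in which every vertex \<open>v\<close> may be used up
  to \<open>c v\<close> times. The elements of \<open>W c E\<close> are thus the monomials of the degree vectors of maximum
  \<open>c\<close>-matchings (\<open>W_eq_maximum_matchings\<close>), and the theorem is a statement about these vectors.

  Let \<open>a\<close> and \<open>b\<close> be the degree vectors of maximum matchings \<open>A\<close> and \<open>B\<close>, with \<open>a \<xi> > b \<xi>\<close> and
  \<open>a \<rho> < b \<rho>\<close>. Alternating trails show that the degree vectors always satisfy the weak exchange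
  property (\<open>alternating_exchange\<close>): one unit of \<open>a\<close> can be moved from \<open>\<xi>\<close> to some \<open>\<rho>'\<close>
  with \<open>a \<rho>' < b \<rho>'\<close>, and one unit can be moved to \<open>\<rho>\<close> from some \<open>\<xi>'\<close> with \<open>a \<xi>' > b \<xi>'\<close>. The
  theorem holds if \<open>\<rho>' = \<rho>\<close> or \<open>\<xi>' = \<xi>\<close>. Otherwise \<open>\<xi>\<close> and \<open>\<xi>'\<close> are two vertices left unsaturated
  by \<open>B\<close>, and \<open>\<rho>\<close> and \<open>\<rho>'\<close> are two vertices left unsaturated by \<open>A\<close>.

  Call a vertex exposed if some maximum matching does not saturate it. By Gallai's lemma, in the form
  of \<open>same_class_trans\<close>, being equal or never unsaturated together is an equivalence relation on the
  exposed vertices. Adjacent vertices are equivalent, since otherwise the edge between them could be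
  added; hence vertices of distinct classes are not adjacent. Here \<open>\<xi>\<close> and \<open>\<xi>'\<close> lie in distinct
  classes, and so do \<open>\<rho>\<close> and \<open>\<rho>'\<close>. If the four vertices are independent, the independence number is
  at least \<open>4\<close>. If two of them are adjacent, say \<open>\<xi>\<close> and \<open>\<rho>\<close>, then their common class contains a
  third vertex adjacent to one of them (\<open>third_exposed_vertex\<close>), and, there being no triangle, two
  non-adjacent vertices. The vertices \<open>\<xi>'\<close> and \<open>\<rho>'\<close> lie outside that class, and they, or two vertices
  of their common class, complete an independent set with four elements. So in every case the
  independence number exceeds \<open>3\<close> (\<open>two_exposed_pairs\<close>).
\<close>

section \<open>Degree vectors of multisets of edges\<close>

definition degrees :: "'v set multiset \<Rightarrow> 'v \<Rightarrow>\<^sub>0 nat" where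
  "degrees M = (\<Sum>e\<in>#M. \<Sum>v\<in>e. Poly_Mapping.single v 1)"

abbreviation deg :: "'v set multiset \<Rightarrow> 'v \<Rightarrow> nat" where
  "deg M v \<equiv> Poly_Mapping.lookup (degrees M) v"

lemma degrees_empty [simp]: "degrees {#} = 0"
  by (simp add: degrees_def)

lemma degrees_union [simp]: "degrees (M + N) = degrees M + degrees N"
  by (simp add: degrees_def)

lemma degrees_add_edge:
  "x \<noteq> y \<Longrightarrow> degrees (add_mset {x, y} M) =
     Poly_Mapping.single x 1 + Poly_Mapping.single y 1 + degrees M"
  by (simp add: degrees_def)

lemma deg_add_edge:
  "x \<noteq> y \<Longrightarrow> deg (add_mset {x, y} M) v = of_bool (v = x) + of_bool (v = y) + deg M v"
  by (simp add: degrees_add_edge lookup_add lookup_single when_def)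

lemma deg_pos_iff: "deg M v > 0 \<longleftrightarrow> (\<exists>e\<in>#M. v \<in> e)" for v :: "'v::finite"
proof (induction M)
  case (add e M)
  have "Poly_Mapping.lookup (\<Sum>u\<in>e. Poly_Mapping.single u (1::nat)) v = of_bool (v \<in> e)"
    by (simp add: lookup_sum lookup_single when_def)
  then show ?case
    using add by (simp add: degrees_def lookup_add)
qed simp

lemma deg_diff: "deg (M - N) v + deg N v = deg (N - M) v + deg M v"
proof -
  have "(M - N) + N = (N - M) + M"
  proof (rule multiset_eqI)
    fix e
    show "count ((M - N) + N) e = count ((N - M) + M) e"
      by (cases "count M e \<le> count N e") simp_all
  qed
  then show ?thesis
    by (metis degrees_union lookup_add)
qed

lemma edge_of_larger_degree:
  fixes v :: "'v::finite"
  assumes "deg N v < deg M v"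
  obtains e where "e \<in># M - N" "v \<in> e"
  using deg_diff[of M N v] assms deg_pos_iff[of "M - N" v] by auto

lemma edge_of_no_smaller_degree:
  fixes v :: "'v::finite"
  assumes "deg N v \<le> deg M v" and "e \<in># N - M" "v \<in> e"
  obtains f where "f \<in># M - N" "v \<in> f"
proof -
  have "deg (N - M) v > 0"
    using assms by (auto simp: deg_pos_iff)
  then have "deg (M - N) v > 0"
    using deg_diff[of M N v] assms(1) by linarith
  then show ?thesis
    using that by (auto simp: deg_pos_iff)
qed


section \<open>Capacity-bounded matchings and their exchange property\<close>

definition bounded_matching :: "'v set set \<Rightarrow> ('v \<Rightarrow> nat) \<Rightarrow> 'v set multiset \<Rightarrow> bool" where
  "bounded_matching E c M \<longleftrightarrow> set_mset M \<subseteq> E \<and> (\<forall>v. deg M v \<le> c v)"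

definition maximum_matching :: "'v set set \<Rightarrow> ('v \<Rightarrow> nat) \<Rightarrow> 'v set multiset \<Rightarrow> bool" where
  "maximum_matching E c M \<longleftrightarrow>
     bounded_matching E c M \<and> (\<forall>N. bounded_matching E c N \<longrightarrow> size N \<le> size M)"

definition loop_free :: "'v set set \<Rightarrow> bool" where
  "loop_free E \<longleftrightarrow> (\<forall>e\<in>E. card e = 2)"

lemma edge_at:
  assumes "loop_free E" "e \<in> E" "x \<in> e"
  obtains y where "e = {x, y}" "x \<noteq> y"
  using assms unfolding loop_free_def card_2_iff
  by (metis doubleton_eq_iff insert_iff singletonD)

lemma sum_degrees:
  fixes M :: "'v::finite set multiset"
  assumes "loop_free E" "set_mset M \<subseteq> E"
  shows "(\<Sum>v\<in>UNIV. deg M v) = 2 * size M"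
  using assms(2)
proof (induction M)
  case (add e M)
  then obtain x y where e: "e = {x, y}" "x \<noteq> y"
    using assms(1) by (auto simp: loop_free_def card_2_iff)
  show ?case
    using add e by (simp add: deg_add_edge sum.distrib)
qed simp

lemma maximum_matching_saturates_neighbour:
  assumes "maximum_matching E c M" "{x, y} \<in> E" "x \<noteq> y" "deg M x < c x"
  shows "deg M y = c y"
proof (rule ccontr)
  assume "deg M y \<noteq> c y"
  then have "deg M y < c y"
    using assms(1) by (simp add: maximum_matching_def bounded_matching_def order_less_le)
  then have "bounded_matching E c (add_mset {x, y} M)"
    using assms by (auto simp: maximum_matching_def bounded_matching_def deg_add_edge)
  then show False
    using assms(1) by (fastforce simp: maximum_matching_def)
qed

lemma maximum_matching_of_size:
  assumes "maximum_matching E c M" "bounded_matching E c N" "size N = size M"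
  shows "maximum_matching E c N"
  using assms by (simp add: maximum_matching_def)

text \<open>
  Starting from \<open>q\<close>, follow a trail that alternates between edges of \<open>R - R'\<close> and of \<open>R' - R\<close>. It cannot
  get stuck after an edge of \<open>R\<close>, because by maximality of \<open>R'\<close> that edge ends in a vertex saturated by
  \<open>R'\<close>. The first vertex with \<open>deg R s < deg R' s\<close> that it reaches after an edge of \<open>R'\<close> is the
  required \<open>s\<close>, and switching along the trail gives \<open>N\<close> and \<open>N'\<close>. Instead of an explicit trail, the
  induction deletes its first two edges \<open>q r\<close> and \<open>r s\<close> and lowers the capacities of \<open>q\<close> and \<open>r\<close>
  by one: this keeps the rest of \<open>R'\<close> maximum, since any matching for the new capacities can be
  extended by the edge \<open>q r\<close>. Both \<open>N\<close> and \<open>N'\<close> are needed: they yield the two exchange properties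
  below, one fixing the vertex that loses a unit and the other the vertex that gains it.
\<close>
lemma alternating_exchange:
  fixes E :: "'v::finite set set"
  assumes E: "loop_free E"
    and "bounded_matching E c R" "maximum_matching E c R'" "deg R' q < deg R q"
  shows "\<exists>s N N'. deg R s < deg R' s \<and>
           set_mset N \<subseteq> E \<and> size N = size R \<and>
           degrees N + Poly_Mapping.single q 1 = degrees R + Poly_Mapping.single s 1 \<and>
           set_mset N' \<subseteq> E \<and> size N' = size R' \<and>
           degrees N' + Poly_Mapping.single s 1 = degrees R' + Poly_Mapping.single q 1"
  using assms(2-)
proof (induction "size R" arbitrary: R R' c q rule: less_induct)
  case less
  let ?e = "\<lambda>v. Poly_Mapping.single v (1::nat)"
  note R = \<open>bounded_matching E c R\<close> and R' = \<open>maximum_matching E c R'\<close>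
    and q = \<open>deg R' q < deg R q\<close>
  have RE: "set_mset R \<subseteq> E" "set_mset R' \<subseteq> E"
    using R R' by (auto simp: bounded_matching_def maximum_matching_def)
  obtain e where e: "e \<in># R - R'" "q \<in> e"
    using q by (rule edge_of_larger_degree)
  have "e \<in> E"
    using e RE by (meson in_diffD subsetD)
  then obtain r where r: "e = {q, r}" "q \<noteq> r"
    using E e(2) by (rule_tac edge_at)
  have "deg R' q < c q"
    using q R by (metis bounded_matching_def order_less_le_trans)
  then have sat: "deg R' r = c r"
    using R' \<open>e \<in> E\<close> r by (auto intro: maximum_matching_saturates_neighbour)
  then have "deg R r \<le> deg R' r"
    using R by (simp add: bounded_matching_def)
  then obtain f where f: "f \<in># R' - R" "r \<in> f"
    using e r by (auto elim: edge_of_no_smaller_degree)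
  have "f \<in> E"
    using f RE by (meson in_diffD subsetD)
  then obtain s where s: "f = {r, s}" "r \<noteq> s"
    using E f(2) by (rule_tac edge_at)
  have "e \<noteq> f"
    using e f by (auto simp: in_diff_count)
  then have "s \<noteq> q"
    using r s by auto
  obtain R1 where R1: "R = add_mset {q, r} R1"
    using e r by (metis in_diffD mset_add)
  obtain R1' where R1': "R' = add_mset {r, s} R1'"
    using f s by (metis in_diffD mset_add)
  have dR: "degrees R = ?e q + ?e r + degrees R1" and dR': "degrees R' = ?e r + ?e s + degrees R1'"
    using R1 R1' r s by (simp_all add: degrees_add_edge)
  have vR: "deg R v = of_bool (v = q) + of_bool (v = r) + deg R1 v"
    and vR': "deg R' v = of_bool (v = r) + of_bool (v = s) + deg R1' v" for v
    using R1 R1' r s by (simp_all add: deg_add_edge)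
  have edges: "set_mset R1 \<subseteq> E" "set_mset R1' \<subseteq> E" "{q, r} \<in> E" "{r, s} \<in> E"
    using R1 R1' RE by auto
  \<comment> \<open>Either the trail ends at \<open>s\<close>, or it continues from \<open>s\<close> in the smaller instance.\<close>
  show ?case
  proof (cases "deg R s < deg R' s")
    case True
    have "degrees (add_mset {r, s} R1) + ?e q = degrees R + ?e s"
      and "degrees (add_mset {q, r} R1') + ?e s = degrees R' + ?e q"
      using dR dR' r s by (simp_all add: degrees_add_edge algebra_simps)
    then show ?thesis
      using True edges R1 R1'
      by (intro exI[of _ s] exI[of _ "add_mset {r, s} R1"] exI[of _ "add_mset {q, r} R1'"]) auto
  next
    case False
    define c1 where "c1 = (\<lambda>v. c v - of_bool (v = q) - of_bool (v = r))"
    have "deg R1 v \<le> c1 v" for v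
    proof -
      have "deg R v \<le> c v"
        using R by (simp add: bounded_matching_def)
      then show ?thesis
        using vR[of v] by (simp add: c1_def)
    qed
    then have b: "bounded_matching E c1 R1"
      using edges by (simp add: bounded_matching_def)
    have "deg R1' v \<le> c1 v" for v
    proof -
      have "deg R' v \<le> c v"
        using R' by (simp add: bounded_matching_def maximum_matching_def)
      then show ?thesis
        using vR'[of v] \<open>deg R' q < c q\<close> r(2) by (auto simp: c1_def split: if_splits)
    qed
    then have b': "bounded_matching E c1 R1'"
      using edges by (simp add: bounded_matching_def)
    have "size S \<le> size R1'" if S: "bounded_matching E c1 S" for S
    proof -
      have "0 < c q" "0 < c r"
        using \<open>deg R' q < c q\<close> sat vR'[of r] by auto
      have "bounded_matching E c (add_mset {q, r} S)"
        unfolding bounded_matching_def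
      proof (intro conjI allI)
        fix v
        have "deg S v \<le> c1 v"
          using S by (simp add: bounded_matching_def)
        then show "deg (add_mset {q, r} S) v \<le> c v"
          using \<open>0 < c q\<close> \<open>0 < c r\<close> r(2) by (auto simp: c1_def deg_add_edge split: if_splits)
      qed (use S edges in \<open>auto simp: bounded_matching_def\<close>)
      then have "size (add_mset {q, r} S) \<le> size R'"
        using R' unfolding maximum_matching_def by blast
      then show ?thesis
        using R1' by simp
    qed
    then have m': "maximum_matching E c1 R1'"
      using b' by (simp add: maximum_matching_def)
    have "size R1 < size R"
      using R1 by simp
    have "deg R1' s < deg R1 s"
      using False vR[of s] vR'[of s] s(2) \<open>s \<noteq> q\<close> by simp
    with less.hyps[OF _ b m'] \<open>size R1 < size R\<close> obtain t N N' where t: "deg R1 t < deg R1' t"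
      and N: "set_mset N \<subseteq> E" "size N = size R1" "degrees N + ?e s = degrees R1 + ?e t"
      and N': "set_mset N' \<subseteq> E" "size N' = size R1'" "degrees N' + ?e t = degrees R1' + ?e s"
      by blast
    have "deg R t < deg R' t"
      using t vR[of t] vR'[of t] q by (cases "t = q") (auto split: if_splits)
    moreover have "degrees (add_mset {r, s} N) + ?e q = degrees R + ?e t"
    proof -
      have "degrees (add_mset {r, s} N) + ?e q = ?e r + ?e q + (degrees N + ?e s)"
        using s by (simp add: degrees_add_edge algebra_simps)
      also have "\<dots> = degrees R + ?e t"
        unfolding N(3) dR by (simp add: algebra_simps)
      finally show ?thesis .
    qed
    moreover have "degrees (add_mset {q, r} N') + ?e t = degrees R' + ?e q"
    proof -
      have "degrees (add_mset {q, r} N') + ?e t = ?e r + ?e q + (degrees N' + ?e t)"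
        using r by (simp add: degrees_add_edge algebra_simps)
      also have "\<dots> = degrees R' + ?e q"
        unfolding N'(3) dR' by (simp add: algebra_simps)
      finally show ?thesis .
    qed
    ultimately show ?thesis
      using N N' edges R1 R1'
      by (intro exI[of _ t] exI[of _ "add_mset {r, s} N"] exI[of _ "add_mset {q, r} N'"]) auto
  qed
qed

lemma deg_exchanged:
  assumes "degrees N + Poly_Mapping.single q 1 = degrees R + Poly_Mapping.single s 1"
  shows "deg N v + of_bool (v = q) = deg R v + of_bool (v = s)"
  using arg_cong[OF assms, of "\<lambda>a. Poly_Mapping.lookup a v"]
  by (auto simp: lookup_add lookup_single when_def split: if_splits)

lemma maximum_matching_exchanged:
  assumes M: "maximum_matching E c M" and "set_mset N \<subseteq> E" "size N = size M"
    and N: "degrees N + Poly_Mapping.single q 1 = degrees M + Poly_Mapping.single s 1"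
    and "deg M s < c s"
  shows "maximum_matching E c N"
proof (rule maximum_matching_of_size[OF M])
  have "deg N v \<le> c v" for v
  proof -
    have "deg M v \<le> c v"
      using M by (simp add: maximum_matching_def bounded_matching_def)
    then show ?thesis
      using deg_exchanged[OF N, of v] assms(5) by (cases "v = s") auto
  qed
  then show "bounded_matching E c N"
    using assms by (simp add: bounded_matching_def)
qed fact

lemma exchange_out:
  fixes E :: "'v::finite set set"
  assumes "loop_free E" and R: "maximum_matching E c R" and R': "maximum_matching E c R'"
    and "deg R' q < deg R q"
  obtains s N where "deg R s < deg R' s" "maximum_matching E c N"
    "degrees N + Poly_Mapping.single q 1 = degrees R + Poly_Mapping.single s 1"
proof -
  obtain s N where s: "deg R s < deg R' s" and N: "set_mset N \<subseteq> E" "size N = size R"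
    "degrees N + Poly_Mapping.single q 1 = degrees R + Poly_Mapping.single s 1"
    using alternating_exchange[OF assms(1) _ R' assms(4)] R unfolding maximum_matching_def by blast
  have "deg R s < c s"
    using s R' by (metis bounded_matching_def maximum_matching_def order_less_le_trans)
  then show ?thesis
    using that s N(3) maximum_matching_exchanged[OF R N] by blast
qed

lemma exchange_in:
  fixes E :: "'v::finite set set"
  assumes "loop_free E" and R: "maximum_matching E c R" and R': "maximum_matching E c R'"
    and "deg R q < deg R' q"
  obtains s N where "deg R' s < deg R s" "maximum_matching E c N"
    "degrees N + Poly_Mapping.single s 1 = degrees R + Poly_Mapping.single q 1"
proof -
  obtain s N where s: "deg R' s < deg R s" and N: "set_mset N \<subseteq> E" "size N = size R"
    "degrees N + Poly_Mapping.single s 1 = degrees R + Poly_Mapping.single q 1"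
    using alternating_exchange[OF assms(1) _ R assms(4)] R' unfolding maximum_matching_def by blast
  have "deg R q < c q"
    using assms(4) R' by (metis bounded_matching_def maximum_matching_def order_less_le_trans)
  then show ?thesis
    using that s N(3) maximum_matching_exchanged[OF R N] by blast
qed


section \<open>Vertices left exposed by maximum matchings\<close>

text \<open>
  The case \<open>x = y\<close> is allowed and means that some maximum matching leaves \<open>x\<close> unsaturated; it does not
  ask for two free units at \<open>x\<close>.
\<close>
definition jointly_exposed :: "'v set set \<Rightarrow> ('v \<Rightarrow> nat) \<Rightarrow> 'v \<Rightarrow> 'v \<Rightarrow> bool" where
  "jointly_exposed E c x y \<longleftrightarrow> (\<exists>M. maximum_matching E c M \<and> deg M x < c x \<and> deg M y < c y)"

abbreviation exposed :: "'v set set \<Rightarrow> ('v \<Rightarrow> nat) \<Rightarrow> 'v \<Rightarrow> bool" where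
  "exposed E c x \<equiv> jointly_exposed E c x x"

text \<open>
  On exposed vertices this is an equivalence relation. If each vertex \<open>v\<close> is replaced by \<open>c v\<close>
  copies, it reflects the components of the set \<open>D\<close> of the Gallai--Edmonds decomposition: the copies
  of vertices in one component are pairwise never missed together.
\<close>
definition same_class :: "'v set set \<Rightarrow> ('v \<Rightarrow> nat) \<Rightarrow> 'v \<Rightarrow> 'v \<Rightarrow> bool" where
  "same_class E c x y \<longleftrightarrow> x = y \<or> \<not> jointly_exposed E c x y"

lemma same_class_sym: "same_class E c x y \<Longrightarrow> same_class E c y x"
  by (auto simp: same_class_def jointly_exposed_def)

text \<open>
  This is the exchange form of Gallai's lemma. If a maximum matching \<open>A\<close> misses both \<open>x\<close> and \<open>z\<close>, move
  one unit of its degree vector away from \<open>y\<close>, towards a maximum matching missing \<open>y\<close>. Only one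
  vertex gains a unit, so \<open>y\<close> is now missed together with \<open>x\<close> or with \<open>z\<close>.
\<close>
lemma same_class_trans:
  fixes E :: "'v::finite set set"
  assumes E: "loop_free E" and y: "exposed E c y"
    and xy: "same_class E c x y" and yz: "same_class E c y z"
  shows "same_class E c x z"
proof (cases "x = y \<or> y = z \<or> x = z")
  case True
  then show ?thesis
    using xy yz by (auto simp: same_class_def)
next
  case False
  show ?thesis
  proof (rule ccontr)
    assume "\<not> same_class E c x z"
    then obtain A where A: "maximum_matching E c A" "deg A x < c x" "deg A z < c z"
      by (auto simp: same_class_def jointly_exposed_def)
    obtain B where B: "maximum_matching E c B" "deg B y < c y"
      using y by (auto simp: jointly_exposed_def)
    have not_both: "\<not> (deg M y < c y \<and> (deg M x < c x \<or> deg M z < c z))"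
      if "maximum_matching E c M" for M
      using that xy yz False by (auto simp: same_class_def jointly_exposed_def)
    have le: "deg M v \<le> c v" if "maximum_matching E c M" for M v
      using that by (simp add: maximum_matching_def bounded_matching_def)
    have "deg B y < deg A y"
      using not_both[OF A(1)] A B(2) by linarith
    then obtain s N where s: "deg A s < deg B s" and N: "maximum_matching E c N"
      "degrees N + Poly_Mapping.single y 1 = degrees A + Poly_Mapping.single s 1"
      using E A(1) B(1) by (rule_tac exchange_out)
    have "s \<noteq> y"
      using s \<open>deg B y < deg A y\<close> by auto
    then have "deg N y < c y"
      using deg_exchanged[OF N(2), of y] le[OF A(1), of y] by simp
    moreover have "deg N x < c x \<or> deg N z < c z"
      using deg_exchanged[OF N(2), of x] deg_exchanged[OF N(2), of z] A False
      by (cases "s = x") auto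
    ultimately show False
      using not_both[OF N(1)] by blast
  qed
qed

lemma adjacent_same_class:
  assumes "loop_free E" "{x, y} \<in> E"
  shows "same_class E c x y"
proof -
  have "x \<noteq> y"
    using assms by (auto simp: loop_free_def)
  then show ?thesis
    using maximum_matching_saturates_neighbour[OF _ assms(2)]
    by (fastforce simp: same_class_def jointly_exposed_def)
qed

text \<open>Replacing the edge \<open>x p\<close> by \<open>x y\<close> in a matching that has room at \<open>y\<close> frees \<open>p\<close>.\<close>
lemma exposed_neighbour_off_edge:
  fixes E :: "'v::finite set set"
  assumes E: "loop_free E" and xy: "{x, y} \<in> E"
    and M: "maximum_matching E c M" "deg M y < c y"
    and p: "{x, p} \<in># M" "p \<noteq> y"
  shows "exposed E c p"
proof -
  have E': "{x, p} \<in> E"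
    using M p by (auto simp: maximum_matching_def bounded_matching_def)
  have ne: "x \<noteq> y" "x \<noteq> p"
    using E xy E' by (auto simp: loop_free_def)
  obtain M1 where M1: "M = add_mset {x, p} M1"
    using p(1) by (metis mset_add)
  let ?N = "add_mset {x, y} M1"
  have N: "degrees ?N + Poly_Mapping.single p 1 = degrees M + Poly_Mapping.single y 1"
    using ne M1 by (simp add: degrees_add_edge algebra_simps)
  have "maximum_matching E c ?N"
    by (rule maximum_matching_exchanged[OF M(1) _ _ N M(2)])
      (use M M1 xy in \<open>auto simp: maximum_matching_def bounded_matching_def\<close>)
  moreover have "deg ?N p < c p"
    using deg_exchanged[OF N, of p] p(2) M(1)
    by (simp add: maximum_matching_def bounded_matching_def)
       (metis Suc_le_lessD)
  ultimately show ?thesis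
    by (auto simp: jointly_exposed_def)
qed

lemma deg_le_of_only_neighbour:
  fixes v :: "'v::finite"
  assumes "loop_free E" "{x, y} \<in> E" "set_mset M \<subseteq> E" "\<And>p. {x, p} \<in># M \<Longrightarrow> p = y"
  shows "deg M x \<le> deg M y"
  using assms(3,4)
proof (induction M)
  case (add e M)
  have "e = {x, y}" if "x \<in> e"
    using edge_at[OF assms(1) _ that] add.prems by (metis insert_subset set_mset_add_mset_insert union_single_eq_member)
  moreover obtain u w where "e = {u, w}" "u \<noteq> w"
    using add.prems(1) assms(1) by (auto simp: loop_free_def card_2_iff)
  moreover have "deg M x \<le> deg M y"
    using add by auto
  ultimately show ?case
    by (auto simp: deg_add_edge)
qed simp

text \<open>
  Let \<open>A\<close> miss \<open>y\<close> and let \<open>B\<close> miss \<open>x\<close>. If \<open>x\<close> has another neighbour \<open>p\<close> in \<open>A\<close>, or \<open>y\<close> has one in \<open>B\<close>,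
  then \<open>p\<close> can be freed. Otherwise \<open>A\<close> uses only the edge \<open>x y\<close> at the saturated vertex \<open>x\<close>, so
  \<open>c x \<le> deg A y < c y\<close>, and symmetrically \<open>c y < c x\<close>.
\<close>
lemma third_exposed_vertex:
  fixes E :: "'v::finite set set"
  assumes E: "loop_free E" and xy: "{x, y} \<in> E"
    and "exposed E c x" "exposed E c y"
  obtains z where "z \<noteq> x" "z \<noteq> y" "exposed E c z" "{x, z} \<in> E \<or> {y, z} \<in> E"
proof -
  obtain A where A: "maximum_matching E c A" "deg A y < c y"
    using assms(4) by (auto simp: jointly_exposed_def)
  obtain B where B: "maximum_matching E c B" "deg B x < c x"
    using assms(3) by (auto simp: jointly_exposed_def)
  have ne: "x \<noteq> y"
    using E xy by (auto simp: loop_free_def)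
  have sub: "set_mset A \<subseteq> E" "set_mset B \<subseteq> E"
    using A B by (auto simp: maximum_matching_def bounded_matching_def)
  have yx: "{y, x} \<in> E"
    using xy by (simp add: insert_commute)
  have "deg A x = c x" "deg B y = c y"
    using maximum_matching_saturates_neighbour A B xy yx ne by metis+
  then have "\<not> (deg A x \<le> deg A y \<and> deg B y \<le> deg B x)"
    using A(2) B(2) by linarith
  then consider p where "{x, p} \<in># A" "p \<noteq> y" | p where "{y, p} \<in># B" "p \<noteq> x"
    using deg_le_of_only_neighbour[OF E xy sub(1)] deg_le_of_only_neighbour[OF E yx sub(2)] by blast
  then show ?thesis
  proof cases
    case 1
    then have "{x, p} \<in> E"
      using sub by auto
    moreover from this have "p \<noteq> x"
      using E by (auto simp: loop_free_def)
    ultimately show ?thesis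
      using that 1 exposed_neighbour_off_edge[OF E xy A 1] by blast
  next
    case 2
    then have "{y, p} \<in> E"
      using sub by auto
    moreover from this have "p \<noteq> y"
      using E by (auto simp: loop_free_def)
    ultimately show ?thesis
      using that 2 exposed_neighbour_off_edge[OF E yx B 2] by blast
  qed
qed

lemma independent_pair_in_class:
  fixes E :: "'v::finite set set"
  assumes E: "loop_free E" and tf: "triangle_free E" and xy: "{x, y} \<in> E"
    and x: "exposed E c x" and y: "exposed E c y"
  obtains p q where "p \<noteq> q" "{p, q} \<notin> E" "exposed E c p" "exposed E c q"
    "same_class E c x p" "same_class E c x q"
proof -
  obtain z where z: "z \<noteq> x" "z \<noteq> y" "exposed E c z" "{x, z} \<in> E \<or> {y, z} \<in> E"
    using third_exposed_vertex[OF E xy x y] .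
  have ne: "x \<noteq> y"
    using E xy by (auto simp: loop_free_def)
  have cxy: "same_class E c x y"
    using adjacent_same_class[OF E xy] .
  have cxz: "same_class E c x z"
    using z(4) adjacent_same_class[OF E] same_class_trans[OF E y cxy] by blast
  have "{x, z} \<notin> E \<or> {y, z} \<notin> E"
  proof (rule ccontr)
    assume "\<not> ?thesis"
    then have "{x, y} \<in> E \<and> {y, z} \<in> E \<and> {z, x} \<in> E"
      using xy by (simp add: insert_commute)
    then show False
      using tf z(1,2) ne unfolding triangle_free_def by auto
  qed
  then show ?thesis
    using that[of x z] that[of y z] x y z cxy cxz by (auto simp: same_class_def)
qed


section \<open>Strong exchange\<close>

lemma independence_number_ge:
  fixes E :: "'v::finite set set"
  assumes "independent_set E A"
  shows "card A \<le> independence_number E"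
proof -
  have "{card A | A. independent_set E A} \<subseteq> card ` (UNIV :: 'v set set)"
    by auto
  then have "finite {card A | A. independent_set E A}"
    by (rule finite_subset) simp
  then show ?thesis
    using assms unfolding independence_number_def by (intro Max_ge) auto
qed

lemma independence_number_ge_4:
  fixes E :: "'v::finite set set"
  assumes E: "loop_free E" and "distinct [p, q, r, s]"
    and "{p, q} \<notin> E" "{p, r} \<notin> E" "{p, s} \<notin> E" "{q, r} \<notin> E" "{q, s} \<notin> E" "{r, s} \<notin> E"
  shows "independence_number E \<ge> 4"
proof -
  have "{v} \<notin> E" for v
    using E by (auto simp: loop_free_def)
  moreover have "{q, p} \<notin> E" "{r, p} \<notin> E" "{s, p} \<notin> E" "{r, q} \<notin> E" "{s, q} \<notin> E" "{s, r} \<notin> E"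
    using assms(3-) by (metis insert_commute)+
  ultimately have "independent_set E {p, q, r, s}"
    using assms(3-) by (simp add: independent_set_def)
  moreover have "card {p, q, r, s} = 4"
    using assms(2) by simp
  ultimately show ?thesis
    using independence_number_ge by metis
qed

lemma independent_pair_of_exposed:
  fixes E :: "'v::finite set set"
  assumes E: "loop_free E" and tf: "triangle_free E"
    and x: "exposed E c x" and y: "exposed E c y" and "x \<noteq> y"
  obtains p q where "p \<noteq> q" "{p, q} \<notin> E" "exposed E c p" "exposed E c q"
    "same_class E c x p \<or> same_class E c y p" "same_class E c x q \<or> same_class E c y q"
proof (cases "{x, y} \<in> E")
  case True
  then show ?thesis
    using independent_pair_in_class[OF E tf _ x y] that by metis
next
  case False
  then show ?thesis
    using that[of x y] assms by (auto simp: same_class_def)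
qed

text \<open>
  No vertex of one class is adjacent to a vertex of another. So it suffices to find two independent
  vertices inside one class and two more outside it: the two classes spanned by the remaining two
  vertices differ from the first, whether they coincide or not.
\<close>
lemma two_exposed_pairs:
  fixes E :: "'v::finite set set"
  assumes E: "loop_free E" and tf: "triangle_free E"
    and x: "jointly_exposed E c x x'" "x \<noteq> x'"
    and y: "jointly_exposed E c y y'" "y \<noteq> y'"
    and disj: "{x, x'} \<inter> {y, y'} = {}"
  shows "independence_number E \<ge> 4"
proof -
  have exp: "exposed E c x" "exposed E c x'" "exposed E c y" "exposed E c y'"
    using x y by (auto simp: jointly_exposed_def)
  have nxx: "\<not> same_class E c x x'" and nyy: "\<not> same_class E c y y'"
    using x y by (auto simp: same_class_def)
  note trans = same_class_trans[OF E] and sym = same_class_sym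
  \<comment> \<open>\<open>u v\<close> is an edge between the two pairs, and \<open>u'\<close>, \<open>v'\<close> are the respective partners.\<close>
  have main: "independence_number E \<ge> 4"
    if uv: "{u, v} \<in> E" and e: "exposed E c u" "exposed E c v" "exposed E c u'" "exposed E c v'"
      and ne: "u' \<noteq> v'" and n: "\<not> same_class E c u u'" "\<not> same_class E c v v'" for u v u' v'
  proof -
    have cuv: "same_class E c u v"
      using adjacent_same_class[OF E uv] .
    have nuv: "\<not> same_class E c u v'"
      using n(2) trans[OF e(1) sym[OF cuv]] by blast
    obtain p q where pq: "p \<noteq> q" "{p, q} \<notin> E" "exposed E c p" "exposed E c q"
      "same_class E c u p" "same_class E c u q"
      using independent_pair_in_class[OF E tf uv e(1,2)] .
    obtain r s where rs: "r \<noteq> s" "{r, s} \<notin> E" "exposed E c r" "exposed E c s"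
      "same_class E c u' r \<or> same_class E c v' r" "same_class E c u' s \<or> same_class E c v' s"
      using independent_pair_of_exposed[OF E tf e(3,4) ne] .
    have classes: "\<not> same_class E c a b"
      if a: "exposed E c a" "same_class E c u a"
        and b: "exposed E c b" "same_class E c u' b \<or> same_class E c v' b" for a b
      using n(1) nuv trans[OF a(1) a(2)] trans[OF b(1)] sym b(2) by metis
    have "a \<noteq> b \<and> {a, b} \<notin> E" if ab: "a \<in> {p, q}" "b \<in> {r, s}" for a b
    proof -
      have "\<not> same_class E c a b"
        using ab pq rs classes by blast
      then show ?thesis
        using adjacent_same_class[OF E] by (auto simp: same_class_def)
    qed
    then have "p \<noteq> r \<and> {p, r} \<notin> E" "p \<noteq> s \<and> {p, s} \<notin> E"
      "q \<noteq> r \<and> {q, r} \<notin> E" "q \<noteq> s \<and> {q, s} \<notin> E"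
      by blast+
    then show ?thesis
      using pq(1,2) rs(1,2) by (intro independence_number_ge_4[OF E, of p q r s]) simp_all
  qed
  show ?thesis
  proof (cases "{x, y} \<in> E \<or> {x, y'} \<in> E \<or> {x', y} \<in> E \<or> {x', y'} \<in> E")
    case True
    have "x' \<noteq> y'" "x' \<noteq> y" "x \<noteq> y'" "x \<noteq> y"
      using disj by auto
    moreover have "\<not> same_class E c x' x" "\<not> same_class E c y' y"
      using nxx nyy same_class_sym[of E c x' x] same_class_sym[of E c y' y] by blast+
    ultimately show ?thesis
      using True main[of x y x' y'] main[of x y' x' y] main[of x' y x y'] main[of x' y' x y]
        exp nxx nyy by blast
  next
    case False
    have "{x, x'} \<notin> E" "{y, y'} \<notin> E"
      using nxx nyy adjacent_same_class[OF E] by auto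
    then show ?thesis
      using False x(2) y(2) disj by (intro independence_number_ge_4[OF E, of x x' y y']) auto
  qed
qed

lemma maximum_matching_strong_exchange:
  fixes E :: "'v::finite set set"
  assumes E: "loop_free E" and tf: "triangle_free E" and ind: "independence_number E \<le> 3"
    and A: "maximum_matching E c A" and B: "maximum_matching E c B"
    and \<xi>: "deg B \<xi> < deg A \<xi>" and \<rho>: "deg A \<rho> < deg B \<rho>"
  obtains N where "maximum_matching E c N"
    "degrees N + Poly_Mapping.single \<xi> 1 = degrees A + Poly_Mapping.single \<rho> 1"
proof -
  obtain \<rho>' N where N: "deg A \<rho>' < deg B \<rho>'" "maximum_matching E c N"
    "degrees N + Poly_Mapping.single \<xi> 1 = degrees A + Poly_Mapping.single \<rho>' 1"
    using exchange_out[OF E A B \<xi>] .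
  obtain \<xi>' N' where N': "deg B \<xi>' < deg A \<xi>'" "maximum_matching E c N'"
    "degrees N' + Poly_Mapping.single \<xi>' 1 = degrees A + Poly_Mapping.single \<rho> 1"
    using exchange_in[OF E A B \<rho>] .
  have slack: "deg M' v < c v" if "deg M' v < deg M v" "maximum_matching E c M" for M M' v
    using that by (metis bounded_matching_def maximum_matching_def order_less_le_trans)
  have "\<rho>' = \<rho> \<or> \<xi>' = \<xi>"
  proof (rule ccontr)
    assume ne: "\<not> (\<rho>' = \<rho> \<or> \<xi>' = \<xi>)"
    have "jointly_exposed E c \<xi> \<xi>'"
      using B slack[OF \<xi> A] slack[OF N'(1) A] by (auto simp: jointly_exposed_def)
    moreover have "jointly_exposed E c \<rho> \<rho>'"
      using A slack[OF \<rho> B] slack[OF N(1) B] by (auto simp: jointly_exposed_def)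
    moreover have "{\<xi>, \<xi>'} \<inter> {\<rho>, \<rho>'} = {}"
      using \<xi> \<rho> N(1) N'(1) by auto
    ultimately have "independence_number E \<ge> 4"
      using two_exposed_pairs[OF E tf] ne by metis
    then show False
      using ind by simp
  qed
  then show ?thesis
    using that N N' by blast
qed


section \<open>Monomial ideals\<close>

definition multiples :: "('v \<Rightarrow>\<^sub>0 nat) set \<Rightarrow> ('v \<Rightarrow>\<^sub>0 nat) set" where
  "multiples S = {s + t | s t. s \<in> S}"

lemma multiplesI: "s \<in> S \<Longrightarrow> s + t \<in> multiples S"
  by (auto simp: multiples_def)

lemma multiplesE:
  assumes "a \<in> multiples S"
  obtains s t where "s \<in> S" "a = s + t"
  using assms by (auto simp: multiples_def)

lemma subset_multiples: "S \<subseteq> multiples S"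
  using multiplesI[where t = 0] by force

lemma multiples_add: "a \<in> multiples S \<Longrightarrow> a + b \<in> multiples S"
  by (metis add.assoc multiplesE multiplesI)

lemma module_mult: "module ((*) :: 'a::comm_ring_1 \<Rightarrow> 'a \<Rightarrow> 'a)"
  by unfold_locales (simp_all add: algebra_simps)

text \<open>
  A polynomial lies in a monomial ideal iff each of its monomials is a multiple of a generator. This
  reduces all questions about the ideals to their sets of exponent vectors.
\<close>
lemma ideal_gen_monom:
  "ideal_gen (monom ` S) =
     {f :: ('v, 'k::field) mpoly. Poly_Mapping.keys f \<subseteq> multiples S}" (is "_ = ?I")
proof
  have "module.subspace (*) ?I"
  proof (rule module.subspaceI[OF module_mult])
    fix f g :: "('v, 'k) mpoly"
    assume "f \<in> ?I" "g \<in> ?I"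
    then show "f + g \<in> ?I"
      using Poly_Mapping.keys_add[of f g] by blast
  next
    fix f g :: "('v, 'k) mpoly"
    assume "g \<in> ?I"
    then have "a + b \<in> multiples S" if "b \<in> Poly_Mapping.keys g" for a b
      using that multiples_add[of b S a] by (auto simp: add.commute)
    then show "f * g \<in> ?I"
      using keys_mult[of f g] by blast
  qed simp
  moreover have "monom ` S \<subseteq> ?I"
    using subset_multiples[of S] by (auto simp: monom_def)
  ultimately show "ideal_gen (monom ` S) \<subseteq> ?I"
    unfolding ideal_gen_def by (intro module.span_minimal[OF module_mult])
next
  show "?I \<subseteq> ideal_gen (monom ` S)"
  proof
    fix f :: "('v, 'k) mpoly"
    assume f: "f \<in> ?I"
    have "Poly_Mapping.single a k \<in> ideal_gen (monom ` S)" if a: "a \<in> multiples S" for a and k :: 'k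
    proof -
      obtain s t where "s \<in> S" "a = s + t"
        using a by (rule multiplesE)
      then have "Poly_Mapping.single a k = Poly_Mapping.single t k * monom s"
        by (simp add: monom_def mult_single add.commute)
      then show ?thesis
        unfolding ideal_gen_def using \<open>s \<in> S\<close>
        by (metis module.span_scale[OF module_mult] module.span_base[OF module_mult] imageI)
    qed
    moreover have "f = (\<Sum>a\<in>Poly_Mapping.keys f. Poly_Mapping.single a (Poly_Mapping.lookup f a))"
      by (rule poly_mapping_eqI) (auto simp: lookup_sum lookup_single when_def in_keys_iff)
    ultimately show "f \<in> ideal_gen (monom ` S)"
      using f unfolding ideal_gen_def
      by (metis (mono_tags, lifting) mem_Collect_eq module.span_sum[OF module_mult] subsetD)
  qed
qed

lemma keys_monom [simp]: "Poly_Mapping.keys (monom a :: ('v, 'k::field) mpoly) = {a}"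
  by (simp add: monom_def)

lemma inj_monom: "inj (monom :: _ \<Rightarrow> ('v, 'k::field) mpoly)"
  by (rule injI) (metis keys_monom singleton_inject)

lemma monom_in_ideal_gen_iff:
  "(monom a :: ('v, 'k::field) mpoly) \<in> ideal_gen (monom ` S) \<longleftrightarrow> a \<in> multiples S"
  by (simp add: ideal_gen_monom)

lemma ideal_gen_monom_eq_iff:
  "ideal_gen (monom ` S) = (ideal_gen (monom ` T) :: ('v, 'k::field) mpoly set) \<longleftrightarrow>
     multiples S = multiples T"
proof
  assume eq: "ideal_gen (monom ` S) = (ideal_gen (monom ` T) :: ('v, 'k) mpoly set)"
  have "a \<in> multiples S \<longleftrightarrow> a \<in> multiples T" for a
    using eq monom_in_ideal_gen_iff[where 'k = 'k] by metis
  then show "multiples S = multiples T"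
    by blast
qed (simp add: ideal_gen_monom)

lemma ideal_gen_products:
  "ideal_gen {f * g | f g. f \<in> ideal_gen (monom ` S) \<and> g \<in> ideal_gen (monom ` T)} =
     (ideal_gen (monom ` {s + t | s t. s \<in> S \<and> t \<in> T}) :: ('v, 'k::field) mpoly set)"
  (is "ideal_gen ?P = ideal_gen (monom ` ?ST)")
proof
  have "f * g \<in> ideal_gen (monom ` ?ST)"
    if fg: "f \<in> ideal_gen (monom ` S)" "g \<in> ideal_gen (monom ` T)" for f g :: "('v, 'k) mpoly"
  proof -
    have "a + b \<in> multiples ?ST" if ab: "a \<in> multiples S" "b \<in> multiples T" for a b
    proof -
      obtain s s' t t' where "s \<in> S" "t \<in> T" "a = s + s'" "b = t + t'"
        using ab by (auto simp: multiples_def)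
      then have "a + b = (s + t) + (s' + t')" "s + t \<in> ?ST"
        by (auto simp: algebra_simps)
      then show ?thesis
        unfolding multiples_def by blast
    qed
    then show ?thesis
      using fg keys_mult[of f g] by (fastforce simp: ideal_gen_monom)
  qed
  then have "?P \<subseteq> ideal_gen (monom ` ?ST)"
    by blast
  then show "ideal_gen ?P \<subseteq> ideal_gen (monom ` ?ST)"
    unfolding ideal_gen_def
    by (intro module.span_minimal[OF module_mult] module.subspace_span[OF module_mult])
next
  have "monom ` ?ST \<subseteq> ?P"
  proof clarify
    fix s t
    assume "s \<in> S" "t \<in> T"
    then have "monom s \<in> ideal_gen (monom ` S)" "monom t \<in> ideal_gen (monom ` T)"
      by (simp_all add: ideal_gen_def module.span_base[OF module_mult])
    moreover have "monom (s + t) = monom s * monom t"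
      by (simp add: monom_def mult_single)
    ultimately show "\<exists>f g. monom (s + t) = f * g \<and> f \<in> ideal_gen (monom ` S) \<and>
        g \<in> ideal_gen (monom ` T)"
      by blast
  qed
  then show "ideal_gen (monom ` ?ST) \<subseteq> ideal_gen ?P"
    unfolding ideal_gen_def by (rule module.span_mono[OF module_mult])
qed

lemma bounded_part_monom:
  "bounded_part c (ideal_gen (monom ` S)) =
     (ideal_gen (monom ` {a \<in> S. \<forall>i. Poly_Mapping.lookup a i \<le> c i}) :: ('v, 'k::field) mpoly set)"
proof -
  let ?b = "\<lambda>a :: 'v \<Rightarrow>\<^sub>0 nat. \<forall>i. Poly_Mapping.lookup a i \<le> c i"
  have gens: "{monom a | a. (monom a :: ('v, 'k) mpoly) \<in> ideal_gen (monom ` S) \<and> ?b a} =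
      monom ` {a \<in> multiples S. ?b a}"
    by (auto simp: monom_in_ideal_gen_iff)
  have "multiples {a \<in> multiples S. ?b a} = multiples {a \<in> S. ?b a}"
  proof
    show "multiples {a \<in> multiples S. ?b a} \<subseteq> multiples {a \<in> S. ?b a}"
    proof
      fix a
      assume "a \<in> multiples {a \<in> multiples S. ?b a}"
      then obtain s t u where "s \<in> S" "?b (s + t)" "a = s + t + u"
        by (auto simp: multiples_def)
      moreover from this have "?b s"
        by (metis lookup_add add_leD1)
      ultimately show "a \<in> multiples {a \<in> S. ?b a}"
        using multiplesI[of s "{a \<in> S. ?b a}" "t + u"] by (simp add: add.assoc)
    qed
    show "multiples {a \<in> S. ?b a} \<subseteq> multiples {a \<in> multiples S. ?b a}"
      using subset_multiples[of S] by (auto simp: multiples_def)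
  qed
  then show ?thesis
    unfolding bounded_part_def gens ideal_gen_monom_eq_iff .
qed

text \<open>
  An antichain \<open>S\<close> is contained in every monomial generating set: a generator dividing \<open>s \<in> S\<close> is itself
  a multiple of some element of \<open>S\<close>, which must then be \<open>s\<close>.
\<close>
lemma minimal_monomial_generators_monom:
  assumes antichain: "\<And>s t. s \<in> S \<Longrightarrow> s + t \<in> S \<Longrightarrow> t = 0"
  shows "minimal_monomial_generators (ideal_gen (monom ` S)) =
           (monom ` S :: ('v, 'k::field) mpoly set)"
proof -
  let ?I = "ideal_gen (monom ` S) :: ('v, 'k) mpoly set"
  have sub: "S \<subseteq> A" if A: "multiples A = multiples S" for A
  proof
    fix s
    assume "s \<in> S"
    then have "s \<in> multiples A"
      unfolding A using subset_multiples[of S] by blast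
    then obtain a t where a: "a \<in> A" "s = a + t"
      by (auto simp: multiples_def)
    then have "a \<in> multiples S"
      unfolding A[symmetric] using subset_multiples[of A] by blast
    then obtain s' t' where s': "s' \<in> S" "a = s' + t'"
      by (auto simp: multiples_def)
    then have "t' + t = 0"
      using antichain[of s' "t' + t"] \<open>s \<in> S\<close> a by (simp add: add.assoc)
    then have "t = 0"
      by (metis add_eq_0_iff_both_eq_0 lookup_add lookup_zero poly_mapping_eqI)
    then show "s \<in> A"
      using a by simp
  qed
  have gens: "monom ` S \<subseteq> M" if M: "M \<subseteq> range monom" "ideal_gen M = ?I" for M :: "('v, 'k) mpoly set"
  proof -
    obtain A where "M = monom ` A"
      using M(1) by (auto elim: subset_imageE)
    then show ?thesis
      using sub M(2) by (auto simp: ideal_gen_monom_eq_iff)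
  qed
  show ?thesis
    unfolding minimal_monomial_generators_def
  proof (rule the_equality)
    have "ideal_gen M' \<noteq> ?I" if "M' \<subset> monom ` S" for M' :: "('v, 'k) mpoly set"
      using gens[of M'] that by auto
    then show "monom ` S \<subseteq> range monom \<and> ideal_gen (monom ` S) = ?I \<and>
        (\<forall>M'. M' \<subset> monom ` S \<longrightarrow> ideal_gen M' \<noteq> ?I)"
      by auto
  next
    fix M :: "('v, 'k) mpoly set"
    assume "M \<subseteq> range monom \<and> ideal_gen M = ?I \<and> (\<forall>M'. M' \<subset> M \<longrightarrow> ideal_gen M' \<noteq> ?I)"
    then show "M = monom ` S"
      using gens[of M] by blast
  qed
qed


section \<open>The bounded powers of an edge ideal\<close>

lemma edge_ideal_power:
  fixes E :: "'v set set"
  assumes E: "loop_free E"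
  shows "ideal_power (edge_ideal E) q =
    (ideal_gen (monom ` {degrees M | M. set_mset M \<subseteq> E \<and> size M = q}) :: ('v, 'k::field) mpoly set)"
proof (induction q)
  case 0
  have "multiples {0 :: 'v \<Rightarrow>\<^sub>0 nat} = UNIV"
    by (auto simp: multiples_def)
  moreover have "{degrees M | M. set_mset M \<subseteq> E \<and> size M = 0} = {0}"
    by auto
  ultimately show ?case
    using ideal_gen_monom[of "{0 :: 'v \<Rightarrow>\<^sub>0 nat}", where 'k = 'k] by simp
next
  case (Suc q)
  let ?D = "\<lambda>q. {degrees M | M. set_mset M \<subseteq> E \<and> size M = q}"
  let ?X = "{Poly_Mapping.single x (1::nat) + Poly_Mapping.single y 1 | x y. {x, y} \<in> E}"
  have ne: "x \<noteq> y" if "{x, y} \<in> E" for x y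
    using that E by (auto simp: loop_free_def)
  have "edge_ideal E = (ideal_gen (monom ` ?X) :: ('v, 'k) mpoly set)"
    unfolding edge_ideal_def by (rule arg_cong[of _ _ ideal_gen]) blast
  moreover have "{s + t | s t. s \<in> ?X \<and> t \<in> ?D q} = ?D (Suc q)"
  proof (intro subset_antisym subsetI)
    fix a
    assume "a \<in> {s + t | s t. s \<in> ?X \<and> t \<in> ?D q}"
    then obtain x y M where M: "{x, y} \<in> E" "set_mset M \<subseteq> E" "size M = q"
      "a = Poly_Mapping.single x 1 + Poly_Mapping.single y 1 + degrees M"
      by blast
    then have "a = degrees (add_mset {x, y} M)"
      using ne by (simp add: degrees_add_edge)
    moreover have "set_mset (add_mset {x, y} M) \<subseteq> E" "size (add_mset {x, y} M) = Suc q"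
      using M by auto
    ultimately show "a \<in> ?D (Suc q)"
      by blast
  next
    fix a
    assume "a \<in> ?D (Suc q)"
    then obtain M where M: "a = degrees M" "set_mset M \<subseteq> E" "size M = Suc q"
      by blast
    then obtain e M1 where M1: "M = add_mset e M1"
      by (metis size_eq_Suc_imp_eq_union)
    then obtain x y where "e = {x, y}" "x \<noteq> y"
      using M E by (auto simp: loop_free_def card_2_iff)
    then have "a = (Poly_Mapping.single x 1 + Poly_Mapping.single y 1) + degrees M1"
      "{x, y} \<in> E" "set_mset M1 \<subseteq> E" "size M1 = q"
      using M M1 by (auto simp: degrees_add_edge)
    then show "a \<in> {s + t | s t. s \<in> ?X \<and> t \<in> ?D q}"
      by blast
  qed
  ultimately show ?case
    using Suc.IH ideal_gen_products[of ?X "?D q"] by simp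
qed

lemma bounded_edge_ideal_power:
  fixes E :: "'v set set"
  assumes E: "loop_free E"
  shows "bounded_part c (ideal_power (edge_ideal E) q) =
    (ideal_gen (monom ` {degrees M | M. bounded_matching E c M \<and> size M = q})
      :: ('v, 'k::field) mpoly set)"
proof -
  have "{a \<in> {degrees M | M. set_mset M \<subseteq> E \<and> size M = q}. \<forall>i. Poly_Mapping.lookup a i \<le> c i} =
      {degrees M | M. bounded_matching E c M \<and> size M = q}"
    by (auto simp: bounded_matching_def)
  then show ?thesis
    by (simp add: edge_ideal_power[OF E] bounded_part_monom)
qed

lemma ideal_gen_monom_eq_zero_iff:
  "ideal_gen (monom ` S) = ({0} :: ('v, 'k::field) mpoly set) \<longleftrightarrow> S = {}"
proof -
  have "ideal_gen (monom ` {}) = ({0} :: ('v, 'k) mpoly set)"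
    using ideal_gen_monom[of "{}", where 'k = 'k] by (simp add: multiples_def)
  moreover have "multiples S = multiples {} \<longleftrightarrow> S = {}"
    by (auto simp: multiples_def)
  ultimately show ?thesis
    by (metis ideal_gen_monom_eq_iff)
qed

text \<open>
  The largest \<open>q\<close> for which a bounded product of \<open>q\<close> edges exists is the size of a maximum matching. All
  exponent vectors of that power have the same total degree, so none properly divides another and
  they are the minimal generators.
\<close>
lemma W_eq_maximum_matchings:
  fixes E :: "'v::finite set set"
  assumes E: "loop_free E"
  shows "W c E = (monom ` degrees ` {M. maximum_matching E c M} :: ('v, 'k::field) mpoly set)"
proof -
  let ?P = "\<lambda>q. \<exists>M. bounded_matching E c M \<and> size M = q"
  define d where "d = (GREATEST q. ?P q)"
  have "bounded_matching E c {#}"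
    by (simp add: bounded_matching_def)
  then have P0: "?P 0"
    by auto
  \<comment> \<open>The sizes are bounded, so that the greatest one is well-defined.\<close>
  have bound: "q \<le> (\<Sum>v\<in>UNIV. c v)" if q: "?P q" for q
  proof -
    obtain M where M: "bounded_matching E c M" "size M = q"
      using q by blast
    then have "2 * q \<le> (\<Sum>v\<in>UNIV. c v)"
      using sum_degrees[OF E, of M] sum_mono[of UNIV "deg M" c] by (simp add: bounded_matching_def)
    then show ?thesis
      by simp
  qed
  have Pd: "?P d" and d_max: "q \<le> d" if "?P q" for q
    using GreatestI_nat[of ?P, OF P0 bound] Greatest_le_nat[of ?P, OF _ bound] that
    unfolding d_def by blast+
  have max_iff: "maximum_matching E c M \<longleftrightarrow> bounded_matching E c M \<and> size M = d" for M
    using Pd[OF P0] d_max unfolding maximum_matching_def by (metis le_antisym)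
  have "delta c (edge_ideal E :: ('v, 'k) mpoly set) = d"
    unfolding delta_def d_def bounded_edge_ideal_power[OF E] ideal_gen_monom_eq_zero_iff
    by (rule arg_cong[of _ _ Greatest]) auto
  then have "W c E = (minimal_monomial_generators
      (ideal_gen (monom ` degrees ` {M. maximum_matching E c M})) :: ('v, 'k) mpoly set)"
    unfolding W_def Let_def bounded_edge_ideal_power[OF E]
    by (simp add: max_iff setcompr_eq_image)
  also have "\<dots> = monom ` degrees ` {M. maximum_matching E c M}"
  proof (rule minimal_monomial_generators_monom)
    fix s t
    assume "s \<in> degrees ` {M. maximum_matching E c M}" "s + t \<in> degrees ` {M. maximum_matching E c M}"
    then obtain M N where "s = degrees M" "s + t = degrees N"
      "bounded_matching E c M" "size M = d" "bounded_matching E c N" "size N = d"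
      by (auto simp: max_iff)
    then have "(\<Sum>v\<in>UNIV. Poly_Mapping.lookup s v) = (\<Sum>v\<in>UNIV. Poly_Mapping.lookup (s + t) v)"
      using sum_degrees[OF E] by (simp add: bounded_matching_def)
    then have "(\<Sum>v\<in>UNIV. Poly_Mapping.lookup t v) = 0"
      by (simp add: lookup_add sum.distrib)
    then show "t = 0"
      by (intro poly_mapping_eqI) simp
  qed
  finally show ?thesis .
qed

theorem lemma3p3:
  fixes E :: "'v::finite set set"
  assumes "simple_graph E"
    and "triangle_free E"
    and "independence_number E \<le> 3"
  shows "strong_exchange_graph TYPE('k::field) E"
proof -
  have E: "loop_free E"
    using assms(1) by (simp add: simple_graph_def loop_free_def)
  have "strong_exchange (W c E :: ('v, 'k) mpoly set)" for c
    unfolding strong_exchange_def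
  proof (intro allI impI)
    fix a b \<xi> \<rho>
    assume a: "monom a \<in> (W c E :: ('v, 'k) mpoly set)"
      and b: "monom b \<in> (W c E :: ('v, 'k) mpoly set)"
      and \<xi>: "Poly_Mapping.lookup b \<xi> < Poly_Mapping.lookup a \<xi>"
      and \<rho>: "Poly_Mapping.lookup a \<rho> < Poly_Mapping.lookup b \<rho>"
    obtain A where A: "a = degrees A" "maximum_matching E c A"
      using a by (auto simp: W_eq_maximum_matchings[OF E] inj_image_mem_iff[OF inj_monom])
    obtain B where B: "b = degrees B" "maximum_matching E c B"
      using b by (auto simp: W_eq_maximum_matchings[OF E] inj_image_mem_iff[OF inj_monom])
    obtain N where N: "maximum_matching E c N"
      "degrees N + Poly_Mapping.single \<xi> 1 = a + Poly_Mapping.single \<rho> 1"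
      using maximum_matching_strong_exchange[OF E assms(2,3) A(2) B(2)] \<xi> \<rho> A B by metis
    have "a - Poly_Mapping.single \<xi> 1 + Poly_Mapping.single \<rho> 1 = degrees N"
    proof (rule poly_mapping_eqI)
      fix v
      show "Poly_Mapping.lookup (a - Poly_Mapping.single \<xi> 1 + Poly_Mapping.single \<rho> 1) v = deg N v"
        using arg_cong[OF N(2), of "\<lambda>a. Poly_Mapping.lookup a v"] \<xi>
        by (auto simp: lookup_add lookup_minus lookup_single when_def split: if_splits)
    qed
    then show "monom (a - Poly_Mapping.single \<xi> 1 + Poly_Mapping.single \<rho> 1) \<in>
        (W c E :: ('v, 'k) mpoly set)"
      using N(1) by (simp add: W_eq_maximum_matchings[OF E])
  qed
  then show ?thesis
    by (simp add: strong_exchange_graph_def)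
qed

end
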